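(* Let $K$ be a disk of radius $h$ centered at the origin, and consider the $p\times p$ stiffness matrix $D$ with entries $D_{m,\ell}=\int_{\partial K}(\nabla\varphi_m\cdot\mathbf n)\,\overline{(\nabla\varphi_\ell\cdot\mathbf n)}\,ds$ resulting from $p$ evenly spaced plane waves. Then the following hold, where $\lambda_L(D)$, $L=0,\dots,p-1$, denote the eigenvalues of the circulant matrix $D$: (1) The generating function of $D$ is $$F_D(x)=\pi h(\kappa h)^2\left[\cos(x)J_0\!\left(2\kappa h\sin\left(\tfrac{x}{2}\right)\right)+J_2\!\left(2\kappa h\sin\left(\tfrac{x}{2}\right)\right)\right].$$ (2) There is a simple eigenvalue $$\lambda_0(D)\approx\frac12\,p\kappa^2h^3\int_0^{2\pi}\left[J_0\!\left(2\kappa h\sin\left(\tfrac{x}{2}\right)\right)\cos(x)+J_2\!\left(2\kappa h\sin\left(\tfrac{x}{2}\right)\right)\right]dx .$$ (3) The multiplicity-2 eigenvalues of $D$ are given, for $L=1,\dots,\left\lfloor\frac{p-1}{2}\right\rfloor$, by $$\lambda_L(D)=\sum_{j=0}^{p-1}F_D\!\left(\tfrac{2j}{p}\pi\right)e^{-i\frac{2j}{p}L\pi}\approx\frac14\,p\kappa^2h^3\int_0^{2\pi}\Big(\left[J_{2L+2}(2\kappa h\sin(t))+J_{2L-2}(2\kappa h\sin(t))\right]+2J_{2L}(2\kappa h\sin(t))\cos(2t)\Big)\,dt .$$ (4) If $p$ is even then there is an additional simple eigenvalue $$\lambda_{p/2}(D)=\sum_{j=0}^{p-1}(-1)^jF_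D\!\left(\tfrac{2j}{p}\pi\right).$$
   Context: Plane waves: $\varphi_m(\mathbf x)=e^{i\kappa\,\mathbf d_m\cdot\mathbf x}$ for $\mathbf x\in\mathbb R^2$, where $\kappa$ is the real wave number and $\mathbf d_m=(\cos\theta_m,\sin\theta_m)$, $\theta_m=2\pi m/p$, $m=0,\dots,p-1$. $\mathbf n$ is the unit outward normal to $\partial K$, $ds$ is arclength, and $J_n$ is the Bessel function of the first kind of integer order $n$. A $p\times p$ circulant matrix $C=\mathrm{circ}[c_0,\dots,c_{p-1}]$ is one whose first row is $c_0,\dots,c_{p-1}$ and in which each row is the right cyclic shift of the row above. Its eigenvalues are $\lambda_L(C)=\sum_{j=0}^{p-1}c_je^{-2\pi ijL/p}$, $L=0,\dots,p-1$. A function $f$ on $[0,2\pi]$ is the generating function of $C$ if $c_j=f(2\pi j/p)$ for all $j$. The symbol $\approx$ denotes approximation by the trapezoidal rule, $\sum_{j=0}^{p-1}F(2\pi j/p)e^{-2\pi ijL/p}\approx\frac{p}{2\pi}\int_0^{2\pi}F(x)e^{-iLx}\,dx$; no error bound is part of the statement.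
   Formalization: The printed constants are too large by h² for unit normal and arclength; F_D, (2) and (3) use πhκ², ½pκ²h and ¼pκ²h. Multiplicities 1, 2, 1 hold when λ_0,…,λ_{⌊p/2⌋} are distinct (they can coincide, e.g. κ=0); the characteristic polynomial's factorization is unconditional. *)

theory Defs
  imports "HOL-Analysis.Analysis" "Jordan_Normal_Form.Char_Poly"
begin

text \<open>The Bessel function of the first kind of integer order \<open>n\<close>, as the power series
  \<open>\<Sum>k. (-1)^k / (k! \<Gamma>(n+k+1)) (x/2)^(n+2k)\<close>. Since \<open>1/\<Gamma>\<close> vanishes at the non-positive integers,
  the series covers negative orders too, and no negative power of \<open>x/2\<close> has a nonzero
  coefficient.\<close>

definition bessel_J :: "int \<Rightarrow> real \<Rightarrow> real" where
  "bessel_J n x =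
     (\<Sum>k. (-1) ^ k / fact k * rGamma (of_int (n + int k + 1)) * (x / 2) powi (n + 2 * int k))"

lemma bessel_J_nat:
  "bessel_J (int n) x = (\<Sum>k. (-1) ^ k / (fact k * fact (n + k)) * (x / 2) ^ (n + 2 * k))"
proof -
  have *: "rGamma (real_of_int (int n + int k + 1)) = 1 / fact (n + k)" for k
  proof -
    have "rGamma (real_of_int (int n + int k + 1)) = rGamma (1 + real (n + k))"
      by (simp add: add_ac)
    also have "\<dots> = 1 / fact (n + k)"
      unfolding rGamma_inverse_Gamma by (subst Gamma_fact) (simp add: field_simps)
    finally show ?thesis .
  qed
  have **: "(x / 2) powi (int n + 2 * int k) = (x / 2) ^ (n + 2 * k)" for k
  proof -
    have "int n + 2 * int k = int (n + 2 * k)" by simp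
    then show ?thesis by (metis power_int_of_nat)
  qed
  show ?thesis
    unfolding bessel_J_def * ** by (simp add: field_simps)
qed

text \<open>The plane \<open>\<real>\<^sup>2\<close> is \<open>real \<times> real\<close> with its Euclidean inner product and norm.\<close>

definition direction :: "nat \<Rightarrow> nat \<Rightarrow> real \<times> real" where
  "direction p m = (cos (2 * pi * real m / real p), sin (2 * pi * real m / real p))"

definition plane_wave :: "real \<Rightarrow> nat \<Rightarrow> nat \<Rightarrow> real \<times> real \<Rightarrow> complex" where
  "plane_wave \<kappa> p m x = exp (\<i> * of_real (\<kappa> * inner (direction p m) x))"

definition gradient :: "(real \<times> real \<Rightarrow> complex) \<Rightarrow> real \<times> real \<Rightarrow> complex \<times> complex" where
  "gradient f x = (frechet_derivative f (at x) (1, 0), frechet_derivative f (at x) (0, 1))"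

definition dot :: "complex \<times> complex \<Rightarrow> real \<times> real \<Rightarrow> complex" where
  "dot g v = fst g * of_real (fst v) + snd g * of_real (snd v)"

definition curve_integral ::
  "(real \<Rightarrow> real \<times> real) \<Rightarrow> real \<Rightarrow> real \<Rightarrow> (real \<times> real \<Rightarrow> complex) \<Rightarrow> complex" where
  "curve_integral \<gamma> a b f =
     integral {a..b} (\<lambda>t. norm (vector_derivative \<gamma> (at t)) *\<^sub>R f (\<gamma> t))"

text \<open>The boundary of the disk \<open>cball 0 h\<close> is traversed once by \<open>circle h\<close> on \<open>[0, 2\<pi>]\<close>; its unit
  outward normal at \<open>x\<close> is \<open>x / |x|\<close>. The lemmas below certify both.\<close>

definition circle :: "real \<Rightarrow> real \<Rightarrow> real \<times> real" where
  "circle h t = (h * cos t, h * sin t)"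

definition outward_normal :: "real \<times> real \<Rightarrow> real \<times> real" where
  "outward_normal x = x /\<^sub>R norm x"

lemma circle_image:
  assumes "h > 0"
  shows "circle h ` {0..2 * pi} = frontier (cball 0 h)"
proof -
  have "x \<in> circle h ` {0..2 * pi}" if "norm x = h" for x
  proof -
    have "(fst x / h)\<^sup>2 + (snd x / h)\<^sup>2 = 1"
      using that assms
      by (auto simp: norm_prod_def power_divide add_divide_distrib[symmetric])
    then obtain t where "0 \<le> t" "t < 2 * pi" "fst x / h = cos t" "snd x / h = sin t"
      using sincos_total_2pi by metis
    with assms show ?thesis
      by (auto simp: circle_def image_def prod_eq_iff field_simps intro!: bexI[of _ t])
  qed
  moreover have "norm (circle h t) = h" for t
  proof -
    have "(h * cos t)\<^sup>2 + (h * sin t)\<^sup>2 = h\<^sup>2"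
      by (simp add: power_mult_distrib distrib_left[symmetric])
    with assms show ?thesis by (simp add: circle_def norm_prod_def)
  qed
  ultimately show ?thesis
    using assms by (auto simp: frontier_cball)
qed

lemma circle_inj_on:
  assumes "h > 0"
  shows "inj_on (circle h) {0..<2 * pi}"
proof (rule inj_onI)
  fix s t assume "s \<in> {0..<2 * pi}" "t \<in> {0..<2 * pi}" "circle h s = circle h t"
  moreover from this assms have "sin s = sin t" "cos s = cos t"
    by (auto simp: circle_def)
  then obtain n :: int where n: "s = t + 2 * pi * n"
    using sin_cos_eq_iff by blast
  ultimately have "\<bar>2 * pi * n\<bar> < 2 * pi * 1" by auto
  then have "\<bar>real_of_int n\<bar> < 1" by (simp add: abs_mult)
  then have "n = 0" by linarith
  with n show "s = t" by simp
qed

lemma outward_normal_unit_outward: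
  assumes "h > 0" "x \<in> frontier (cball 0 h)"
  shows "norm (outward_normal x) = 1"
    and "y \<in> cball 0 h \<Longrightarrow> inner (outward_normal x) (y - x) \<le> 0"
proof -
  have x: "norm x = h" using assms by (simp add: frontier_cball)
  with assms show "norm (outward_normal x) = 1" by (auto simp: outward_normal_def)
  assume "y \<in> cball 0 h"
  then have "norm y \<le> h" by simp
  with assms(1) have "h * norm y \<le> h * h" by (intro mult_left_mono) auto
  with norm_cauchy_schwarz[of x y] x have "inner x y \<le> h * h" by simp
  moreover have "inner x x = h * h" using x by (simp add: dot_square_norm power2_eq_square)
  ultimately have "inner x (y - x) \<le> 0" by (simp add: inner_diff_right)
  with x assms show "inner (outward_normal x) (y - x) \<le> 0"
    by (simp add: outward_normal_def mult_le_0_iff)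
qed

definition stiffness_matrix :: "real \<Rightarrow> real \<Rightarrow> nat \<Rightarrow> complex mat" where
  "stiffness_matrix \<kappa> h p = Matrix.mat p p (\<lambda>(m, l).
     curve_integral (circle h) 0 (2 * pi)
       (\<lambda>x. dot (gradient (plane_wave \<kappa> p m) x) (outward_normal x) *
            cnj (dot (gradient (plane_wave \<kappa> p l) x) (outward_normal x))))"

text \<open>First row \<open>c 0, \<dots>, c (p - 1)\<close>, each row the right cyclic shift of the row above.\<close>

definition circ :: "nat \<Rightarrow> (nat \<Rightarrow> complex) \<Rightarrow> complex mat" where
  "circ p c = Matrix.mat p p (\<lambda>(m, l). c ((l + p - m) mod p))"

definition circ_eigenvalue :: "complex mat \<Rightarrow> nat \<Rightarrow> complex" where
  "circ_eigenvalue C L =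
     (\<Sum>j<dim_row C. C $$ (0, j) *
        exp (- (2 * of_real pi * \<i> * of_nat j * of_nat L / of_nat (dim_row C))))"

definition generating_function :: "nat \<Rightarrow> (real \<Rightarrow> real) \<Rightarrow> complex mat \<Rightarrow> bool" where
  "generating_function p f C \<longleftrightarrow>
     (\<exists>c. C = circ p c \<and> (\<forall>j<p. c j = of_real (f (2 * pi * real j / real p))))"

text \<open>\<open>trapezoidal_approx p F L s v\<close> is the relation \<open>s \<approx> v\<close>: \<open>s\<close> is the trapezoidal sum of
  \<open>F x * exp (- \<i> L x)\<close> over the \<open>p\<close> equidistant nodes in \<open>[0, 2\<pi>]\<close>, and \<open>v\<close> is \<open>p / (2\<pi>)\<close> times
  the integral it approximates. No bound on \<open>s - v\<close> is asserted.\<close>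

definition trapezoidal_approx ::
  "nat \<Rightarrow> (real \<Rightarrow> real) \<Rightarrow> nat \<Rightarrow> complex \<Rightarrow> complex \<Rightarrow> bool" where
  "trapezoidal_approx p F L s v \<longleftrightarrow>
     s = (\<Sum>j<p. of_real (F (2 * pi * real j / real p)) *
            exp (- (2 * of_real pi * \<i> * of_nat j * of_nat L / of_nat p))) \<and>
     (\<exists>I. ((\<lambda>x. of_real (F x) * exp (- (\<i> * of_nat L * of_real x))) has_integral I) {0..2 * pi} \<and>
          v = of_nat p / (2 * of_real pi) * I)"

text \<open>The prefactor is \<open>\<pi> h \<kappa>\<^sup>2\<close>. The source prints \<open>\<pi> h (\<kappa> h)\<^sup>2\<close>, which is off by the factor \<open>h\<^sup>2\<close>
  for the unit normal and arclength: each diagonal entry of the stiffness matrix is the integral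
  of \<open>\<kappa>\<^sup>2 cos\<^sup>2\<close> of the angle between normal and wave direction, that is \<open>\<pi> h \<kappa>\<^sup>2\<close>, while the bracket
  below equals 1 at \<open>x = 0\<close>. The same factor \<open>h\<^sup>2\<close> is dropped from the constants of the integral
  approximations of the eigenvalues. All constants agree with the printed ones when \<open>h = 1\<close>.\<close>

definition F_D :: "real \<Rightarrow> real \<Rightarrow> real \<Rightarrow> real" where
  "F_D \<kappa> h x = pi * h * \<kappa>\<^sup>2 *
     (cos x * bessel_J 0 (2 * \<kappa> * h * sin (x / 2)) + bessel_J 2 (2 * \<kappa> * h * sin (x / 2)))"

end

theory Submission
  imports Defs
begin

text \<open>A circulant matrix is diagonalised by the Fourier vectors \<open>m \<mapsto> \<omega>\<^sup>m\<^sup>L\<close>, so its characteristic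
  polynomial is \<open>\<Prod>L<p. (X - \<lambda>\<^sub>L)\<close>; since \<open>F_D\<close> is even and \<open>2\<pi>\<close>-periodic, \<open>\<lambda>\<^sub>p\<^sub>-\<^sub>L = \<lambda>\<^sub>L\<close> and the factors
  pair up.

  Everything analytic rests on Bessel's integral \<open>2\<pi> J\<^sub>n(w) = \<integral> exp (\<i> w sin s - \<i> n s) ds\<close>. Centring
  the angle of integration at the mean of the two wave directions turns an entry of \<open>D\<close> into such
  integrals with \<open>n = 0\<close> and \<open>n = 2\<close>. For the Fourier coefficients of \<open>F_D\<close>, inserting Bessel's integral
  and exchanging the integrations shows that \<open>\<integral> J\<^sub>a(z sin t) exp (- \<i> b t) dt\<close> is symmetric in \<open>a\<close> and
  \<open>b\<close>, which moves the frequency \<open>L\<close> into the order of the Bessel function.\<close>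

section \<open>Circulant matrices\<close>

text \<open>The negative sign in the exponent makes the powers of this root coincide with the
  factors in \<open>circ_eigenvalue\<close>.\<close>

definition unity_root :: "nat \<Rightarrow> complex" where
  "unity_root p = exp (- (2 * of_real pi * \<i> / of_nat p))"

lemma unity_root_power: "unity_root p ^ k = exp (- (2 * of_real pi * \<i> * of_nat k / of_nat p))"
  unfolding unity_root_def exp_of_nat_mult[symmetric] by (simp add: algebra_simps)

text \<open>Turns identities between Fourier factors into congruences of natural exponents modulo
  \<open>p\<close>.\<close>

lemma unity_root_power_eq_iff:
  assumes "p \<ge> 1"
  shows "unity_root p ^ j = unity_root p ^ k \<longleftrightarrow> j mod p = k mod p"
  using complex_root_unity_eq[OF assms, of j k] unfolding unity_root_power exp_minus by simp

text \<open>The summands are powers of a single \<open>p\<close>-th root of unity \<open>x\<close>,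
  which equals 1 only if \<open>L = M\<close>; otherwise the geometric sum vanishes because
  \<open>x ^ p = 1\<close>.\<close>

lemma unity_root_orthogonal:
  assumes "L < p" "M < p"
  shows "(\<Sum>m<p. unity_root p ^ (L * m) * inverse (unity_root p) ^ (m * M)) =
         (if L = M then of_nat p else 0)"
proof -
  let ?z = "unity_root p"
  define x where "x = ?z ^ L * inverse ?z ^ M"
  have z0: "?z \<noteq> 0" by (simp add: unity_root_def)
  have p1: "p \<ge> 1" using assms by simp
  have zp: "?z ^ p = 1" using unity_root_power_eq_iff[OF p1, of p 0] by simp
  have "x ^ p = (?z ^ p) ^ L * inverse (?z ^ p) ^ M"
    by (simp add: x_def power_mult_distrib power_inverse flip: power_mult) (simp add: mult.commute)
  then have xp: "x ^ p = 1" using zp by simp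
  have sum: "(\<Sum>m<p. ?z ^ (L * m) * inverse ?z ^ (m * M)) = (\<Sum>m<p. x ^ m)"
    by (simp add: x_def power_mult_distrib mult.commute flip: power_mult)
  show ?thesis
  proof (cases "L = M")
    case True
    then have "x = 1" using z0 by (simp add: x_def power_inverse)
    then show ?thesis using sum True by simp
  next
    case False
    have "x \<noteq> 1"
    proof
      assume "x = 1"
      then have "?z ^ L = ?z ^ M" using z0 by (simp add: x_def power_inverse field_simps)
      then show False using unity_root_power_eq_iff[OF p1] assms False by simp
    qed
    then show ?thesis using sum xp False by (simp add: sum_gp_strict)
  qed
qed

lemma circ_eigenvalue_circ:
  "circ_eigenvalue (circ p c) L = (\<Sum>j<p. c j * unity_root p ^ (j * L))"
  unfolding circ_eigenvalue_def unity_root_power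
  by (auto simp: circ_def mult.assoc intro!: sum.cong)

text \<open>The eigenvector equation, row by row: row \<open>m\<close> is the first row shifted by
  \<open>m\<close>, so substituting \<open>l = m + j\<close> modulo \<open>p\<close> pulls out the
  factor belonging to \<open>m\<close>.\<close>

lemma circ_fourier_vector:
  assumes "m < p"
  shows "(\<Sum>l<p. c ((l + p - m) mod p) * unity_root p ^ (l * L)) =
         unity_root p ^ (m * L) * circ_eigenvalue (circ p c) L"
proof -
  have p1: "p \<ge> 1" using assms by simp
  have "(\<Sum>l<p. c ((l + p - m) mod p) * unity_root p ^ (l * L)) =
        (\<Sum>j<p. c j * unity_root p ^ ((m + j) * L))"
  proof (rule sum.reindex_bij_witness[where i = "\<lambda>j. (j + m) mod p" and j = "\<lambda>l. (l + p - m) mod p"])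
    fix l assume l: "l \<in> {..<p}"
    have *: "((l + p - m) mod p + m) mod p = l"
    proof -
      have "((l + p - m) mod p + m) mod p = (l + p - m + m) mod p" by (rule mod_add_left_eq)
      also have "l + p - m + m = l + p" using assms by simp
      finally show ?thesis using l by simp
    qed
    then show "((l + p - m) mod p + m) mod p = l" .
    \<comment> \<open>The wrap-around of the index does not matter, as the exponent only counts
      modulo \<open>p\<close>.\<close>
    have "unity_root p ^ (m + (l + p - m) mod p) = unity_root p ^ l"
      using * l unfolding unity_root_power_eq_iff[OF p1] by (simp add: add.commute)
    then show "c ((l + p - m) mod p) * unity_root p ^ ((m + (l + p - m) mod p) * L) =
               c ((l + p - m) mod p) * unity_root p ^ (l * L)"
      by (simp add: power_mult)
  next
    fix j assume j: "j \<in> {..<p}"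
    have "((j + m) mod p + p - m) mod p = ((j + m) mod p + (p - m)) mod p" using assms by simp
    also have "\<dots> = (j + m + (p - m)) mod p" by (rule mod_add_left_eq)
    also have "\<dots> = j" using assms j by simp
    finally show "((j + m) mod p + p - m) mod p = j" .
  qed (use p1 in auto)
  then show ?thesis
    by (simp add: circ_eigenvalue_circ sum_distrib_left algebra_simps power_add)
qed

text \<open>The Fourier vectors form the columns of \<open>F\<close>, and \<open>G\<close> is its
  inverse by orthogonality, so the circulant matrix is similar to the diagonal matrix
  \<open>E\<close>. Passing to the characteristic polynomial retains algebraic multiplicities even
  where eigenvalues coincide.\<close>

lemma char_poly_circ:
  "char_poly (circ p c) = (\<Prod>L<p. [:- circ_eigenvalue (circ p c) L, 1:])"
proof -
  let ?ev = "circ_eigenvalue (circ p c)" and ?z = "unity_root p"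
  define F where "F = Matrix.mat p p (\<lambda>(m, L). ?z ^ (m * L))"
  define G where "G = Matrix.mat p p (\<lambda>(L, m). inverse ?z ^ (L * m) / of_nat p)"
  define E where "E = Matrix.mat p p (\<lambda>(L, M). if L = M then ?ev L else 0)"
  have carrier: "F \<in> carrier_mat p p" "G \<in> carrier_mat p p" "E \<in> carrier_mat p p"
    "circ p c \<in> carrier_mat p p"
    by (auto simp: F_def G_def E_def circ_def)
  have FG: "F * G = 1\<^sub>m p"
  proof (rule eq_matI)
    fix i j assume "i < dim_row (1\<^sub>m p)" "j < dim_col (1\<^sub>m p)"
    then show "(F * G) $$ (i, j) = 1\<^sub>m p $$ (i, j)"
      using unity_root_orthogonal[of i p j]
      by (auto simp: F_def G_def scalar_prod_def atLeast0LessThan simp flip: sum_divide_distrib)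
  qed (auto simp: F_def G_def)
  \<comment> \<open>A one-sided inverse of a square matrix is two-sided, so orthogonality is summed
    in one order only.\<close>
  have GF: "G * F = 1\<^sub>m p"
    using mat_mult_left_right_inverse[OF carrier(1,2) FG] .
  have "circ p c * F = F * E"
  proof (rule eq_matI)
    fix i j assume "i < dim_row (F * E)" "j < dim_col (F * E)"
    then have ij: "i < p" "j < p" by (auto simp: F_def E_def)
    have "(\<Sum>k<p. ?z ^ (i * k) * (if k = j then ?ev k else 0)) = ?z ^ (i * j) * ?ev j"
      using ij by (simp add: if_distrib cong: if_cong)
    then show "(circ p c * F) $$ (i, j) = (F * E) $$ (i, j)"
      using circ_fourier_vector[of i p c j] ij
      by (simp add: F_def E_def circ_def scalar_prod_def atLeast0LessThan)
  qed (auto simp: F_def E_def circ_def)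
  then have "circ p c * (F * G) = F * E * G"
    by (simp flip: assoc_mult_mat[OF carrier(4,1,2)])
  then have "circ p c = F * E * G"
    by (simp add: FG right_mult_one_mat[OF carrier(4)])
  then have "similar_mat (circ p c) E"
    unfolding similar_mat_def similar_mat_wit_def Let_def
    using carrier FG GF by (intro exI[of _ F] exI[of _ G]) auto
  moreover have "char_poly E = (\<Prod>L<p. [:- ?ev L, 1:])"
  proof -
    have "upper_triangular E" by (auto simp: E_def)
    then have "char_poly E = (\<Prod>a\<leftarrow>diag_mat E. [:- a, 1:])"
      using char_poly_upper_triangular[OF carrier(3)] by blast
    also have "diag_mat E = map ?ev [0..<p]"
      by (auto simp: diag_mat_def E_def)
    finally show ?thesis
      using prod.distinct_set_conv_list[of "[0..<p]" "\<lambda>L. [:- ?ev L, 1:]"]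
      by (simp add: o_def atLeast0LessThan)
  qed
  ultimately show ?thesis using char_poly_similar by metis
qed

section \<open>Root multiplicities and the reflection of eigenvalues\<close>

lemma order_prod_linear:
  fixes f :: "'b \<Rightarrow> 'a :: idom"
  assumes "finite A"
  shows "Polynomial.order a (\<Prod>x\<in>A. [:- f x, 1:]) = card {x\<in>A. f x = a}"
  using assms
proof (induction A rule: finite_induct)
  case (insert x A)
  \<comment> \<open>Orders add under multiplication only for a nonzero product.\<close>
  have "[:- f x, 1:] * (\<Prod>x\<in>A. [:- f x, 1:]) \<noteq> 0"
    using insert by (simp add: prod_zero_iff del: mult_pCons_left)
  moreover have "Polynomial.order a [:- f x, 1:] = (if f x = a then 1 else 0)"
    using order_power_n_n[of a 1] by (auto intro!: order_0I)
  moreover have "{y \<in> insert x A. f y = a} = (if f x = a then insert x {y\<in>A. f y = a} else {y\<in>A. f y = a})"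
    by auto
  ultimately show ?case using insert by (auto simp: order_mult simp del: mult_pCons_left)
qed simp

text \<open>Besides 0, the indices below \<open>p\<close> consist of the lower half, its mirror
  image under \<open>p - L\<close>, and, for even \<open>p\<close>, the fixed point
  \<open>p div 2\<close>.\<close>

lemma prod_lessThan_symmetric:
  fixes f :: "nat \<Rightarrow> 'a :: comm_monoid_mult"
  assumes "p \<ge> 1" and sym: "\<And>L. 1 \<le> L \<Longrightarrow> L < p \<Longrightarrow> f (p - L) = f L"
  shows "(\<Prod>L<p. f L) = f 0 * (\<Prod>L = 1..(p - 1) div 2. f L ^ 2) * (if even p then f (p div 2) else 1)"
proof -
  let ?A = "{1..(p - 1) div 2}" and ?M = "if even p then {p div 2} else {}"
  have refl: "(\<Prod>L\<in>(\<lambda>L. p - L) ` ?A. f L) = (\<Prod>L\<in>?A. f L)"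
    by (subst prod.reindex) (auto simp: inj_on_def sym intro!: prod.cong)
  have "{..<p} = insert 0 (?A \<union> (\<lambda>L. p - L) ` ?A \<union> ?M)"
  proof (intro equalityI subsetI)
    fix L assume L: "L \<in> {..<p}"
    then consider "L = 0" | "L \<in> ?A" | "p - L \<in> ?A" "L = p - (p - L)" | "2 * L = p"
      by fastforce
    then show "L \<in> insert 0 (?A \<union> (\<lambda>L. p - L) ` ?A \<union> ?M)"
      by cases (blast, blast, blast, auto)
  qed (use assms(1) in \<open>auto split: if_splits\<close>)
  moreover have "0 \<notin> ?A \<union> (\<lambda>L. p - L) ` ?A \<union> ?M"
    using assms(1) by auto
  ultimately have "(\<Prod>L<p. f L) = f 0 * (\<Prod>L\<in>?A \<union> (\<lambda>L. p - L) ` ?A \<union> ?M. f L)"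
    by (metis prod.insert finite_lessThan finite_insert)
  also have "(\<Prod>L\<in>?A \<union> (\<lambda>L. p - L) ` ?A \<union> ?M. f L) =
             (\<Prod>L\<in>?A \<union> (\<lambda>L. p - L) ` ?A. f L) * (\<Prod>L\<in>?M. f L)"
    by (rule prod.union_disjoint) auto
  also have "(\<Prod>L\<in>?A \<union> (\<lambda>L. p - L) ` ?A. f L) =
             (\<Prod>L\<in>?A. f L) * (\<Prod>L\<in>(\<lambda>L. p - L) ` ?A. f L)"
    by (rule prod.union_disjoint) auto
  finally show ?thesis
    unfolding refl by (simp add: power2_eq_square prod.distrib mult.assoc)
qed

text \<open>Replacing \<open>j\<close> by \<open>- j\<close> modulo \<open>p\<close> preserves the
  coefficients and turns the frequency \<open>L\<close> into \<open>- L\<close>, which is congruent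
  to \<open>p - L\<close>.\<close>

lemma circ_eigenvalue_reflect:
  assumes L: "L \<le> p" and sym: "\<And>j. 1 \<le> j \<Longrightarrow> j < p \<Longrightarrow> c (p - j) = c j"
  shows "circ_eigenvalue (circ p c) (p - L) = circ_eigenvalue (circ p c) L"
  unfolding circ_eigenvalue_circ
proof (rule sum.reindex_bij_witness[where i = "\<lambda>j. (p - j) mod p" and j = "\<lambda>j. (p - j) mod p"])
  fix j assume j: "j \<in> {..<p}"
  then have p1: "p \<ge> 1" by simp
  \<comment> \<open>Complements replace the truncated subtractions; adding multiples of
    \<open>p\<close> to both sides then makes the congruence an equality of natural numbers.\<close>
  obtain a where a: "p = j + a" using j by (metis lessThan_iff less_imp_add_positive)
  obtain b where b: "p = L + b" using L le_Suc_ex by blast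
  have "(p - j) * L + j * p = a * L + j * (L + b)" using a b by (metis add_diff_cancel_left')
  also have "\<dots> = j * b + (j + a) * L" by (simp add: algebra_simps)
  also have "\<dots> = j * (p - L) + L * p" using a b by (metis add_diff_cancel_left' mult.commute)
  finally have "((p - j) * L + j * p) mod p = (j * (p - L) + L * p) mod p" by simp
  then have "(p - j) mod p * L mod p = j * (p - L) mod p"
    by (simp add: mod_mult_left_eq)
  then have "unity_root p ^ ((p - j) mod p * L) = unity_root p ^ (j * (p - L))"
    unfolding unity_root_power_eq_iff[OF p1] .
  moreover have "c ((p - j) mod p) = c j"
    using j sym[of j] by (cases "j = 0") auto
  ultimately show "c ((p - j) mod p) * unity_root p ^ ((p - j) mod p * L) =
                   c j * unity_root p ^ (j * (p - L))" by simp
  show "(p - (p - j) mod p) mod p = j" using j by (cases "j = 0") auto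
  show "(p - j) mod p \<in> {..<p}" using p1 by simp
next
  fix j assume j: "j \<in> {..<p}"
  show "(p - (p - j) mod p) mod p = j" using j by (cases "j = 0") auto
  show "(p - j) mod p \<in> {..<p}" using j by simp
qed

text \<open>Injectivity on the lower half leaves only the coincidences forced by reflection. Cutting
  with \<open>{..<p}\<close> removes the partner \<open>p\<close> of \<open>M = 0\<close>, and the
  pair collapses at \<open>2 * M = p\<close>, so one count covers simple and double roots.\<close>

lemma order_prod_reflect:
  fixes f :: "nat \<Rightarrow> 'a :: idom"
  assumes sym: "\<And>L. L \<le> p \<Longrightarrow> f (p - L) = f L" and inj: "inj_on f {0..p div 2}" and M: "M \<le> p div 2"
  shows "Polynomial.order (f M) (\<Prod>L<p. [:- f L, 1:]) = card ({M, p - M} \<inter> {..<p})"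
proof -
  have "L = M \<or> L = p - M" if "L < p" "f L = f M" for L
  proof (cases "L \<le> p div 2")
    case True
    then show ?thesis using inj_onD[OF inj that(2)] M by simp
  next
    case False
    then have "p - L \<le> p div 2" by linarith
    moreover have "f (p - L) = f M" using sym[of L] that by simp
    ultimately have "p - L = M" using inj_onD[OF inj, of "p - L" M] M by simp
    then show ?thesis using that(1) by linarith
  qed
  moreover have "f (p - M) = f M" using sym M by simp
  ultimately have "{L \<in> {..<p}. f L = f M} = {M, p - M} \<inter> {..<p}" by auto
  then show ?thesis by (simp add: order_prod_linear)
qed

section \<open>Bessel's integral\<close>

text \<open>For nonzero \<open>m\<close> the antiderivative is itself periodic, so its values at the
  two endpoints cancel for any shift.\<close>

lemma has_integral_exp_period:
  fixes m :: int
  shows "((\<lambda>s. exp (\<i> * of_int m * of_real (s - \<alpha>))) has_integral (if m = 0 then 2 * of_real pi else 0)) {0..2 * pi}"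
proof (cases "m = 0")
  case True
  then show ?thesis
    using has_integral_const_real[of "1 :: complex" 0 "2 * pi"] by (simp add: scaleR_conv_of_real)
next
  case False
  define F where "F s = exp (\<i> * of_int m * of_real (s - \<alpha>)) / (\<i> * of_int m)" for s :: real
  have "((\<lambda>z. exp (\<i> * of_int m * (z - of_real \<alpha>)) / (\<i> * of_int m)) has_field_derivative
         exp (\<i> * of_int m * (of_real s - of_real \<alpha>))) (at (of_real s))" for s :: real
    using False by (auto intro!: derivative_eq_intros)
  from has_vector_derivative_real_field[OF this]
  have "(F has_vector_derivative exp (\<i> * of_int m * of_real (s - \<alpha>))) (at s within {0..2 * pi})" for s
    unfolding F_def of_real_diff .
  then have "((\<lambda>s. exp (\<i> * of_int m * of_real (s - \<alpha>))) has_integral F (2 * pi) - F 0) {0..2 * pi}"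
    by (intro fundamental_theorem_of_calculus) auto
  moreover have "F (2 * pi) = F 0"
  proof -
    have "exp (\<i> * of_int m * of_real (2 * pi - \<alpha>)) =
          exp (\<i> * of_int m * of_real (0 - \<alpha>) + of_int m * (of_real (2 * pi) * \<i>))"
      by (simp add: algebra_simps)
    also have "\<dots> = exp (\<i> * of_int m * of_real (0 - \<alpha>))"
      unfolding exp_add using exp_integer_2pi[of "of_int m"] by (simp add: mult_ac)
    finally show ?thesis by (simp add: F_def)
  qed
  ultimately show ?thesis using False by simp
qed

text \<open>Binomial expansion gives exponentials of frequency \<open>k - 2 * j - n\<close>; only
  frequency zero survives integration over a period.\<close>

lemma has_integral_sin_power:
  fixes n k :: nat
  shows "((\<lambda>s. (exp (\<i> * of_real (s - \<alpha>)) - exp (- (\<i> * of_real (s - \<alpha>)))) ^ k *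
             exp (- (\<i> * of_nat n * of_real (s - \<alpha>))))
     has_integral (\<Sum>j\<le>k. of_nat (k choose j) * (- 1) ^ j * (if k = n + 2 * j then 2 * of_real pi else 0))) {0..2 * pi}"
proof -
  have eq: "(exp (\<i> * x) - exp (- (\<i> * x))) ^ k * exp (- (\<i> * of_nat n * x)) =
        (\<Sum>j\<le>k. of_nat (k choose j) * (- 1) ^ j * exp (\<i> * of_int (int k - 2 * int j - int n) * x))"
    for x :: complex
  proof -
    \<comment> \<open>The negative term goes first so that \<open>j\<close> counts the factors with
      the minus sign.\<close>
    have "(exp (\<i> * x) - exp (- (\<i> * x))) ^ k = (- exp (- (\<i> * x)) + exp (\<i> * x)) ^ k" by simp
    also have "\<dots> = (\<Sum>j\<le>k. of_nat (k choose j) * (- exp (- (\<i> * x))) ^ j * exp (\<i> * x) ^ (k - j))"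
      by (rule binomial_ring)
    finally have 1: "(exp (\<i> * x) - exp (- (\<i> * x))) ^ k = \<dots>" .
    have 2: "of_nat (k choose j) * (- exp (- (\<i> * x))) ^ j * exp (\<i> * x) ^ (k - j) * exp (- (\<i> * of_nat n * x)) =
      of_nat (k choose j) * (- 1) ^ j * exp (\<i> * of_int (int k - 2 * int j - int n) * x)" if "j \<le> k" for j
    proof -
      have "exp (- (\<i> * x)) ^ j * exp (\<i> * x) ^ (k - j) * exp (- (\<i> * of_nat n * x)) =
            exp (of_nat j * (- (\<i> * x)) + of_nat (k - j) * (\<i> * x) + - (\<i> * of_nat n * x))"
        by (simp only: exp_of_nat_mult exp_add)
      also have "of_nat j * (- (\<i> * x)) + of_nat (k - j) * (\<i> * x) + - (\<i> * of_nat n * x) =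
                 \<i> * of_int (int k - 2 * int j - int n) * x"
        using that by (simp add: of_nat_diff algebra_simps)
      finally show ?thesis
        unfolding power_minus[of "exp (- (\<i> * x))"] by (simp add: mult_ac)
    qed
    show ?thesis
      unfolding 1 sum_distrib_right by (intro sum.cong refl 2) simp
  qed
  have iff: "int k - 2 * int j - int n = 0 \<longleftrightarrow> k = n + 2 * j" for j by auto
  have "((\<lambda>s. exp (\<i> * of_int (int k - 2 * int j - int n) * of_real (s - \<alpha>))) has_integral
         (if k = n + 2 * j then 2 * of_real pi else 0)) {0..2 * pi}" for j
    using has_integral_exp_period[of "int k - 2 * int j - int n" \<alpha>] unfolding iff .
  then show ?thesis
    unfolding eq by (intro has_integral_sum has_integral_mult_right finite_atMost)
qed

text \<open>Stated with a shift \<open>\<alpha>\<close>: the integrals are evaluated term by term, where a shift costs nothing, and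
  translations of periodic integrals are never needed.\<close>
lemma has_integral_bessel:
  fixes n :: nat
  shows "((\<lambda>s. exp (\<i> * of_real (w * sin (s - \<alpha>))) * exp (- (\<i> * of_nat n * of_real (s - \<alpha>))))
     has_integral 2 * of_real pi * of_real (bessel_J (int n) w)) {0..2 * pi}"
proof -
  define u where "u s = exp (\<i> * of_real (s - \<alpha>)) - exp (- (\<i> * of_real (s - \<alpha>)))" for s :: real
  define e where "e s = exp (- (\<i> * of_nat n * of_real (s - \<alpha>)))" for s :: real
  \<comment> \<open>The \<open>k\<close>-th term of the exponential series at
    \<open>\<i> * w * sin (s - \<alpha>)\<close>, times the Fourier factor.\<close>
  define f where "f k s = (of_real (w / 2) * u s) ^ k /\<^sub>R fact k * e s" for k s
  have u: "u s = 2 * \<i> * of_real (sin (s - \<alpha>))" for s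
    unfolding u_def sin_of_real[symmetric] sin_exp_eq by (simp add: field_simps)
  have nu: "norm (u s) \<le> 2" for s unfolding u by (simp add: norm_mult)
  have ne: "norm (e s) = 1" for s unfolding e_def by (simp add: norm_exp_eq_Re)
  \<comment> \<open>Uniform convergence permits termwise integration;
    \<open>norm (u s) \<le> 2\<close> cancels the 2 in \<open>w / 2\<close> and leaves the
    exponential series of \<open>\<bar>w\<bar>\<close> as majorant.\<close>
  have lim: "uniform_limit {0..2 * pi} (\<lambda>N s. \<Sum>k<N. f k s) (\<lambda>s. \<Sum>k. f k s) sequentially"
  proof (rule Weierstrass_m_test)
    show "summable (\<lambda>k. \<bar>w\<bar> ^ k /\<^sub>R fact k)" by (rule summable_exp_generic)
    fix k s
    have "norm (of_real (w / 2) * u s) \<le> \<bar>w\<bar> / 2 * 2"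
      unfolding norm_mult by (intro mult_mono) (use nu in auto)
    then have "norm (of_real (w / 2) * u s) ^ k \<le> \<bar>w\<bar> ^ k" by (intro power_mono) auto
    moreover have "norm (f k s) = norm (of_real (w / 2) * u s) ^ k /\<^sub>R fact k"
      unfolding f_def norm_mult[of _ "e s"] ne norm_scaleR norm_power by simp
    ultimately show "norm (f k s) \<le> \<bar>w\<bar> ^ k /\<^sub>R fact k"
      by (simp add: divide_right_mono)
  qed
  have cont: "continuous_on {0..2 * pi} (\<lambda>s. \<Sum>k<N. f k s)" for N
    unfolding f_def u_def e_def by (intro continuous_intros)
  obtain I J where IJ: "\<And>N. ((\<lambda>s. \<Sum>k<N. f k s) has_integral I N) {0..2 * pi}"
    "((\<lambda>s. \<Sum>k. f k s) has_integral J) {0..2 * pi}" "I \<longlonglongrightarrow> J"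
    using uniform_limit_integral[OF lim cont] by auto
  define b where "b j = (- 1) ^ j / (fact j * fact (n + j)) * (w / 2) ^ (n + 2 * j)" for j
  define c where "c k = of_real (w / 2) ^ k /\<^sub>R fact k * (\<Sum>j\<le>k. of_nat (k choose j) * (- 1) ^ j *
       (if k = n + 2 * j then 2 * complex_of_real pi else 0))" for k
  have "(f k has_integral c k) {0..2 * pi}" for k
  proof -
    have "f k = (\<lambda>s. of_real (w / 2) ^ k /\<^sub>R fact k * (u s ^ k * e s))"
      by (rule ext) (simp add: f_def power_mult_distrib[of _ "u _"] del: of_real_divide)
    then show ?thesis
      unfolding c_def using has_integral_sin_power[of \<alpha> k n]
      by (simp only: u_def e_def has_integral_mult_right)
  qed
  then have "((\<lambda>s. \<Sum>k<N. f k s) has_integral (\<Sum>k<N. c k)) {0..2 * pi}" for N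
    by (intro has_integral_sum) auto
  then have "I = (\<lambda>N. \<Sum>k<N. c k)" using IJ(1) has_integral_unique by blast
  then have "c sums J" using IJ(3) by (simp add: sums_def)
  moreover have "strict_mono (\<lambda>j. n + 2 * j)" by (auto simp: strict_mono_def)
  \<comment> \<open>Only \<open>k = n + 2 * j\<close> contributes, so the series may be reindexed by
    \<open>j\<close>.\<close>
  moreover have "c k = 0" if "k \<notin> range (\<lambda>j. n + 2 * j)" for k
  proof -
    from that have "k \<noteq> n + 2 * j" for j by blast
    then show ?thesis by (simp add: c_def)
  qed
  ultimately have "(\<lambda>j. c (n + 2 * j)) sums J"
    using sums_mono_reindex[of "\<lambda>j. n + 2 * j" c J] by blast
  moreover have "c (n + 2 * j) =
    of_real (2 * pi * ((- 1) ^ j / (fact j * fact (n + j)) * (w / 2) ^ (n + 2 * j)))" for j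
  proof -
    have "(\<Sum>i\<le>n + 2 * j. of_nat (n + 2 * j choose i) * (- 1) ^ i *
       (if n + 2 * j = n + 2 * i then 2 * complex_of_real pi else 0)) =
       (\<Sum>i\<in>{j}. of_nat (n + 2 * j choose i) * (- 1) ^ i * (2 * complex_of_real pi))"
      by (rule sum.mono_neutral_cong_right) auto
    then have "c (n + 2 * j) = of_real (w / 2) ^ (n + 2 * j) /\<^sub>R fact (n + 2 * j) *
        (of_nat (n + 2 * j choose j) * (- 1) ^ j * (2 * complex_of_real pi))"
      by (simp add: c_def)
    \<comment> \<open>Divided by \<open>fact (n + 2 * j)\<close>, this binomial coefficient becomes
      the Bessel coefficient \<open>1 / (fact j * fact (n + j))\<close>.\<close>
    also have "of_nat (n + 2 * j choose j) = (fact (n + 2 * j) / (fact j * fact (n + j)) :: complex)"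
      by (subst binomial_fact) (auto simp: mult_2)
    finally show ?thesis by (simp add: scaleR_conv_of_real field_simps)
  qed
  ultimately have J: "(\<lambda>j. complex_of_real (2 * pi * b j)) sums J"
    by (simp only: b_def)
  have "(\<lambda>j. 2 * pi * b j) sums Re J" using sums_Re[OF J] by (simp only: Re_complex_of_real)
  then have "b sums (Re J / (2 * pi))" using sums_mult_D[of "2 * pi" b "Re J"] by simp
  then have "Re J = 2 * pi * bessel_J (int n) w"
    by (simp add: bessel_J_nat b_def[abs_def] sums_iff)
  moreover have "Im J = 0" using sums_Im[OF J] by (simp add: sums_iff)
  ultimately have "J = 2 * of_real pi * of_real (bessel_J (int n) w)"
    by (simp add: complex_eq_iff)
  moreover have "(\<Sum>k. f k s) = exp (\<i> * of_real (w * sin (s - \<alpha>))) * e s" for s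
  proof -
    have "of_real (w / 2) * u s = \<i> * of_real (w * sin (s - \<alpha>))" by (simp add: u)
    then show ?thesis
      unfolding f_def exp_def by (simp only: suminf_mult2[OF summable_exp_generic])
  qed
  ultimately show ?thesis using IJ(2) by (simp add: e_def)
qed

section \<open>Parity, continuity and Fourier integrals of Bessel functions\<close>

lemma bessel_J_even: "even n \<Longrightarrow> bessel_J (int n) (- x) = bessel_J (int n) x"
  by (simp add: bessel_J_nat flip: minus_divide_left)

lemma of_real_bessel_J:
  "of_real (bessel_J (int n) w) =
     integral {0..2 * pi} (\<lambda>s. exp (\<i> * of_real (w * sin s)) * exp (- (\<i> * of_nat n * of_real s))) /
       (2 * of_real pi)"
  using integral_unique[OF has_integral_bessel[of w 0 n]] by simp

text \<open>Bessel's integral has a jointly continuous integrand over a compact interval, so it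
  depends continuously on the parameter.\<close>

lemma continuous_on_bessel_J: "continuous_on A (bessel_J (int n))"
proof -
  have "continuous_on A (\<lambda>w. integral (cbox 0 (2 * pi))
       (\<lambda>s. exp (\<i> * of_real (w * sin s)) * exp (- (\<i> * of_nat n * of_real s))))"
    by (rule integral_continuous_on_param)
       (auto simp: case_prod_unfold intro!: continuous_intros)
  then have "continuous_on A (\<lambda>w. Re (of_real (bessel_J (int n) w)))"
    unfolding of_real_bessel_J by (intro continuous_intros) auto
  then show ?thesis by simp
qed

lemma continuous_on_bessel_J_compose [continuous_intros]:
  "continuous_on A f \<Longrightarrow> continuous_on A (\<lambda>x. bessel_J (int n) (f x))"
  using continuous_on_compose2[OF continuous_on_bessel_J] by blast

text \<open>The literal orders 0 and 2 do not have the form \<open>int n\<close>, hence these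
  separate instances.\<close>

lemmas continuous_on_bessel_J_0 [continuous_intros] =
  continuous_on_bessel_J_compose[where n = 0, unfolded of_nat_0]

lemmas continuous_on_bessel_J_2 [continuous_intros] =
  continuous_on_bessel_J_compose[where n = 2, unfolded of_nat_numeral]

text \<open>After inserting Bessel's integral the double integrand \<open>g\<close> is invariant
  under exchanging \<open>(a, s)\<close> with \<open>(b, t)\<close>, since
  \<open>sin t * sin s\<close> is symmetric; Fubini does the rest.\<close>

lemma integral_bessel_J_swap:
  "integral {0..2 * pi} (\<lambda>t. of_real (bessel_J (int a) (z * sin t)) * exp (- (\<i> * of_nat b * of_real t))) =
   integral {0..2 * pi} (\<lambda>t. of_real (bessel_J (int b) (z * sin t)) * exp (- (\<i> * of_nat a * of_real t)))"
proof -
  define g where "g a b s t = exp (\<i> * of_real (z * sin t * sin s)) * exp (- (\<i> * of_nat a * of_real s)) *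
     exp (- (\<i> * of_nat b * of_real t))" for a b :: nat and s t :: real
  have *: "integral {0..2 * pi} (\<lambda>t. of_real (bessel_J (int a) (z * sin t)) * exp (- (\<i> * of_nat b * of_real t))) =
    integral {0..2 * pi} (\<lambda>t. integral {0..2 * pi} (\<lambda>s. g a b s t)) / (2 * of_real pi)" for a b
    by (simp add: of_real_bessel_J g_def integral_divide)
  have "integral (cbox 0 (2 * pi)) (\<lambda>t. integral (cbox 0 (2 * pi)) (\<lambda>s. g a b s t)) =
        integral (cbox 0 (2 * pi)) (\<lambda>s. integral (cbox 0 (2 * pi)) (\<lambda>t. g a b s t))"
    by (rule integral_swap_continuous)
       (auto simp: g_def case_prod_unfold intro!: continuous_intros)
  moreover have "g a b s t = g b a t s" for s t
    by (simp add: g_def mult_ac)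
  ultimately show ?thesis unfolding * by simp
qed

text \<open>As \<open>t\<close> runs over \<open>{0..2 * pi}\<close>, \<open>2 * t\<close> covers
  two periods, each contributing half of \<open>I\<close>. This turns the argument
  \<open>sin (x / 2)\<close> of \<open>F_D\<close> into \<open>sin t\<close>.\<close>

lemma has_integral_double_angle:
  fixes f :: "real \<Rightarrow> 'a :: banach"
  assumes f: "(f has_integral I) {0..2 * pi}" and per: "\<And>x. f (x + 2 * pi) = f x"
  shows "((\<lambda>t. f (2 * t)) has_integral I) {0..2 * pi}"
proof -
  have 1: "((\<lambda>t. f (2 * t)) has_integral I /\<^sub>R 2) {0..pi}"
    using has_integral_affinity'[of f I 0 "2 * pi" 2 0] f by simp
  have "((\<lambda>t. f (2 * (t - pi))) has_integral I /\<^sub>R 2) {pi..2 * pi}"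
    using has_integral_affinity'[of f I 0 "2 * pi" 2 "- 2 * pi"] f
    by (simp add: algebra_simps)
  moreover have "f (2 * (t - pi)) = f (2 * t)" for t
    using per[of "2 * (t - pi)"] by (simp add: algebra_simps)
  ultimately have 2: "((\<lambda>t. f (2 * t)) has_integral I /\<^sub>R 2) {pi..2 * pi}" by simp
  have "I /\<^sub>R 2 + I /\<^sub>R 2 = I"
    by (simp flip: scaleR_add_left)
  then show ?thesis using has_integral_combine[OF _ _ 1 2] by simp
qed

lemma has_integral_reflect_period:
  fixes f :: "real \<Rightarrow> 'a :: banach"
  assumes "(f has_integral I) {0..2 * pi}"
  shows "((\<lambda>x. f (2 * pi - x)) has_integral I) {0..2 * pi}"
  using has_integral_affinity[of f I 0 "2 * pi" "- 1" "2 * pi"] assms by simp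

text \<open>Under \<open>t \<mapsto> 2 * pi - t\<close> the Bessel factor is unchanged, because its
  order is even, while the sine changes sign; the integral equals its own negative.\<close>

lemma integral_bessel_J_sin_eq_0:
  assumes "even n"
  shows "integral {0..2 * pi} (\<lambda>t. bessel_J (int n) (z * sin t) * sin (of_nat m * t)) = 0"
proof -
  let ?f = "\<lambda>t. bessel_J (int n) (z * sin t) * sin (of_nat m * t)"
  have "?f integrable_on {0..2 * pi}"
    by (intro integrable_continuous_real continuous_intros)
  then have "(?f has_integral integral {0..2 * pi} ?f) {0..2 * pi}" by (rule integrable_integral)
  moreover have "?f (2 * pi - t) = - ?f t" for t
  proof -
    have "sin (of_nat m * (2 * pi - t)) = sin (- (of_nat m * t) + of_nat m * (2 * pi))"
      by (simp add: algebra_simps)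
    also have "\<dots> = - sin (of_nat m * t)"
      unfolding sin_add using cos_2npi[of m] sin_2npi[of m] by (simp add: mult_ac)
    finally show ?thesis using bessel_J_even[OF assms, of "z * sin t"] by (simp add: sin_diff)
  qed
  ultimately have "((\<lambda>t. - ?f t) has_integral integral {0..2 * pi} ?f) {0..2 * pi}"
    using has_integral_reflect_period[of ?f "integral {0..2 * pi} ?f"] by simp
  then have "integral {0..2 * pi} (\<lambda>t. - ?f t) = integral {0..2 * pi} ?f" by (rule integral_unique)
  then show ?thesis by simp
qed

section \<open>The generating function\<close>

text \<open>A shift by \<open>2 * pi\<close> flips the sign of \<open>sin (x / 2)\<close>, which the
  even orders 0 and 2 absorb.\<close>

lemma F_D_periodic: "F_D \<kappa> h (x + 2 * pi) = F_D \<kappa> h x"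
proof -
  have "sin ((x + 2 * pi) / 2) = - sin (x / 2)"
    by (simp add: add_divide_distrib)
  then show ?thesis
    unfolding F_D_def
    using bessel_J_even[of 0 "2 * \<kappa> * h * sin (x / 2)"] bessel_J_even[of 2 "2 * \<kappa> * h * sin (x / 2)"]
    by simp
qed

lemma F_D_even: "F_D \<kappa> h (- x) = F_D \<kappa> h x"
  unfolding F_D_def
  using bessel_J_even[of 0 "2 * \<kappa> * h * sin (x / 2)"] bessel_J_even[of 2 "2 * \<kappa> * h * sin (x / 2)"]
  by simp

lemma continuous_on_F_D [continuous_intros]: "continuous_on A (F_D \<kappa> h)"
  unfolding F_D_def by (intro continuous_intros) auto

text \<open>After \<open>x = 2 * t\<close> the orders are 0 and 2 and the frequencies carry
  \<open>L\<close>; the swap exchanges these roles. Order 0 yields orders \<open>2 * L + 2\<close>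
  and \<open>2 * L - 2\<close> at frequency 0, and order 2 yields order \<open>2 * L\<close> at
  frequency 2.\<close>

lemma has_integral_F_D_fourier:
  assumes L: "L \<ge> 1"
  shows "((\<lambda>x. of_real (F_D \<kappa> h x) * exp (- (\<i> * of_nat L * of_real x))) has_integral
    of_real (pi * h * \<kappa>\<^sup>2 / 2 * integral {0..2 * pi} (\<lambda>t.
       (bessel_J (2 * int L + 2) (2 * \<kappa> * h * sin t) +
        bessel_J (2 * int L - 2) (2 * \<kappa> * h * sin t)) +
       2 * bessel_J (2 * int L) (2 * \<kappa> * h * sin t) * cos (2 * t)))) {0..2 * pi}"
proof -
  define z where "z = 2 * \<kappa> * h"
  define G where "G x = of_real (F_D \<kappa> h x) * exp (- (\<i> * of_nat L * of_real x))" for x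
  define K where "K a b t = of_real (bessel_J (int a) (z * sin t)) * exp (- (\<i> * of_nat b * of_real t))"
    for a b :: nat and t :: real
  have contK: "K a b integrable_on {0..2 * pi}" for a b
    unfolding K_def by (intro integrable_continuous_real continuous_intros)
  have swap: "integral {0..2 * pi} (K a b) = integral {0..2 * pi} (K b a)" for a b
    unfolding K_def by (rule integral_bessel_J_swap)
  have per: "G (x + 2 * pi) = G x" for x
  proof -
    have "exp (- (\<i> * of_nat L * of_real (x + 2 * pi))) =
          exp (- (\<i> * of_nat L * of_real x) + of_int (- int L) * (of_real (2 * pi) * \<i>))"
      by (simp add: algebra_simps)
    also have "\<dots> = exp (- (\<i> * of_nat L * of_real x))"
      unfolding exp_add using exp_integer_2pi[of "of_int (- int L)"] by (simp add: mult_ac)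
    finally show ?thesis by (simp add: G_def F_D_periodic)
  qed
  have "G integrable_on {0..2 * pi}"
    unfolding G_def by (intro integrable_continuous_real continuous_intros)
  then have G: "(G has_integral integral {0..2 * pi} G) {0..2 * pi}" by (rule integrable_integral)
  \<comment> \<open>Writing \<open>cos (2 * t)\<close> by exponentials shifts the frequency
    \<open>2 * L\<close> by 2 both ways; \<open>L \<ge> 1\<close> keeps \<open>2 * L - 2\<close>
    from being truncated.\<close>
  have G2: "G (2 * t) = of_real (pi * h * \<kappa>\<^sup>2) *
      (K 0 (2 * L - 2) t / 2 + K 0 (2 * L + 2) t / 2 + K 2 (2 * L) t)" for t
  proof -
    let ?e = "exp (- (\<i> * of_nat (2 * L) * of_real t))"
    have cos: "complex_of_real (cos (2 * t)) =
       (exp (2 * \<i> * of_real t) + exp (- (2 * \<i> * of_real t))) / 2"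
      unfolding cos_of_real[symmetric] cos_exp_eq by (simp add: mult_ac)
    have e1: "exp (2 * \<i> * of_real t) * ?e = exp (- (\<i> * of_nat (2 * L - 2) * of_real t))"
      unfolding exp_add[symmetric] using L by (simp add: of_nat_diff algebra_simps)
    have e2: "exp (- (2 * \<i> * of_real t)) * ?e = exp (- (\<i> * of_nat (2 * L + 2) * of_real t))"
      unfolding exp_add[symmetric] by (simp add: algebra_simps)
    have "G (2 * t) = of_real (pi * h * \<kappa>\<^sup>2) *
       (of_real (bessel_J 0 (z * sin t)) * of_real (cos (2 * t)) * ?e + K 2 (2 * L) t)"
      by (simp add: G_def F_D_def K_def z_def algebra_simps)
    also have "of_real (bessel_J 0 (z * sin t)) * of_real (cos (2 * t)) * ?e =
       K 0 (2 * L - 2) t / 2 + K 0 (2 * L + 2) t / 2"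
      unfolding cos K_def e1[symmetric] e2[symmetric] by (simp add: algebra_simps add_divide_distrib)
    finally show ?thesis .
  qed
  let ?j = "\<lambda>n t. bessel_J (int n) (z * sin t)"
  have K0: "(K n 0 has_integral of_real (integral {0..2 * pi} (?j n))) {0..2 * pi}" for n
  proof -
    have "?j n integrable_on {0..2 * pi}"
      by (intro integrable_continuous_real continuous_intros)
    from has_integral_of_real[OF integrable_integral[OF this]]
    show ?thesis by (simp add: K_def[abs_def])
  qed
  \<comment> \<open>The exponential of frequency 2 is
    \<open>cos (2 * t) - \<i> * sin (2 * t)\<close>, and its sine part integrates to zero.\<close>
  have K2: "(K (2 * L) 2 has_integral of_real (integral {0..2 * pi} (\<lambda>t. ?j (2 * L) t * cos (2 * t)))) {0..2 * pi}"
  proof -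
    let ?c = "\<lambda>t. ?j (2 * L) t * cos (2 * t)" and ?s = "\<lambda>t. ?j (2 * L) t * sin (2 * t)"
    have c: "(?c has_integral integral {0..2 * pi} ?c) {0..2 * pi}"
      by (intro integrable_integral integrable_continuous_real continuous_intros)
    have "(?s has_integral integral {0..2 * pi} ?s) {0..2 * pi}"
      by (intro integrable_integral integrable_continuous_real continuous_intros)
    then have s: "(?s has_integral 0) {0..2 * pi}"
      using integral_bessel_J_sin_eq_0[of "2 * L" z 2] by simp
    have "K (2 * L) 2 t = of_real (?c t) - \<i> * of_real (?s t)" for t
    proof -
      have "exp (- (\<i> * of_nat 2 * of_real t)) = cis (- (2 * t))"
        by (simp add: cis_conv_exp mult_ac)
      then show ?thesis
        unfolding K_def by (simp add: complex_eq_iff)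
    qed
    then have "K (2 * L) 2 = (\<lambda>t. of_real (?c t) - \<i> * of_real (?s t))" by blast
    moreover have "((\<lambda>t. complex_of_real (?c t) - \<i> * of_real (?s t)) has_integral
        of_real (integral {0..2 * pi} ?c) - \<i> * of_real 0) {0..2 * pi}"
      by (intro has_integral_diff has_integral_mult_right has_integral_of_real c s)
    ultimately show ?thesis by simp
  qed
  have "((\<lambda>t. G (2 * t)) has_integral of_real (pi * h * \<kappa>\<^sup>2) *
      (integral {0..2 * pi} (K 0 (2 * L - 2)) / 2 + integral {0..2 * pi} (K 0 (2 * L + 2)) / 2 +
       integral {0..2 * pi} (K 2 (2 * L)))) {0..2 * pi}"
    unfolding G2
    by (intro has_integral_mult_right has_integral_add has_integral_divide integrable_integral contK)
  then have "integral {0..2 * pi} G = of_real (pi * h * \<kappa>\<^sup>2) *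
      (integral {0..2 * pi} (K 0 (2 * L - 2)) / 2 + integral {0..2 * pi} (K 0 (2 * L + 2)) / 2 +
       integral {0..2 * pi} (K 2 (2 * L)))"
    using has_integral_double_angle[OF G per] has_integral_unique by blast
  \<comment> \<open>Here \<open>swap\<close> moves \<open>L\<close> from the frequencies into the
    orders.\<close>
  also have "\<dots> = of_real (pi * h * \<kappa>\<^sup>2 / 2 *
     (integral {0..2 * pi} (?j (2 * L + 2)) + integral {0..2 * pi} (?j (2 * L - 2)) +
      2 * integral {0..2 * pi} (\<lambda>t. ?j (2 * L) t * cos (2 * t))))"
    unfolding swap[of 0] swap[of 2 "2 * L"] integral_unique[OF K0] integral_unique[OF K2]
    by (simp add: field_simps)
  also have "integral {0..2 * pi} (?j (2 * L + 2)) + integral {0..2 * pi} (?j (2 * L - 2)) +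
      2 * integral {0..2 * pi} (\<lambda>t. ?j (2 * L) t * cos (2 * t)) =
      integral {0..2 * pi} (\<lambda>t. (?j (2 * L + 2) t + ?j (2 * L - 2) t) + 2 * (?j (2 * L) t * cos (2 * t)))"
    by (intro integral_unique[symmetric] has_integral_add has_integral_mult_right integrable_integral
          integrable_continuous_real continuous_intros)
  also have "(\<lambda>t. (?j (2 * L + 2) t + ?j (2 * L - 2) t) + 2 * (?j (2 * L) t * cos (2 * t))) =
     (\<lambda>t. (bessel_J (2 * int L + 2) (2 * \<kappa> * h * sin t) +
        bessel_J (2 * int L - 2) (2 * \<kappa> * h * sin t)) +
       2 * bessel_J (2 * int L) (2 * \<kappa> * h * sin t) * cos (2 * t))"
    using L by (simp add: z_def of_nat_diff mult.assoc add.commute fun_eq_iff)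
  finally show ?thesis
    using G unfolding G_def[abs_def] by (simp only:)
qed

lemma has_integral_F_D:
  "((\<lambda>x. F_D \<kappa> h x) has_integral pi * h * \<kappa>\<^sup>2 * integral {0..2 * pi} (\<lambda>x.
      bessel_J 0 (2 * \<kappa> * h * sin (x / 2)) * cos x + bessel_J 2 (2 * \<kappa> * h * sin (x / 2)))) {0..2 * pi}"
proof -
  let ?f = "\<lambda>x. bessel_J 0 (2 * \<kappa> * h * sin (x / 2)) * cos x + bessel_J 2 (2 * \<kappa> * h * sin (x / 2))"
  have "continuous_on {0..2 * pi} ?f"
    by (intro continuous_intros) auto
  then have "(?f has_integral integral {0..2 * pi} ?f) {0..2 * pi}"
    by (intro integrable_integral integrable_continuous_real)
  then have "((\<lambda>x. pi * h * \<kappa>\<^sup>2 * ?f x) has_integral pi * h * \<kappa>\<^sup>2 * integral {0..2 * pi} ?f) {0..2 * pi}"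
    by (rule has_integral_mult_right)
  then show ?thesis by (simp add: F_D_def[abs_def] mult.commute)
qed

section \<open>Entries of the stiffness matrix\<close>

lemma has_integral_bessel_cos:
  "((\<lambda>t. of_real (cos x + cos (2 * (t - \<alpha>))) * exp (\<i> * of_real (w * sin (t - \<alpha>)))) has_integral
     of_real (2 * pi * (cos x * bessel_J 0 w + bessel_J 2 w))) {0..2 * pi}"
proof -
  have J0: "((\<lambda>t. exp (\<i> * of_real (w * sin (t - \<alpha>)))) has_integral
      2 * of_real pi * of_real (bessel_J 0 w)) {0..2 * pi}"
    using has_integral_bessel[of w \<alpha> 0] by simp
  have J2: "((\<lambda>t. exp (\<i> * of_real (v * sin (t - \<alpha>))) * exp (- (2 * \<i> * of_real (t - \<alpha>)))) has_integral
      2 * of_real pi * of_real (bessel_J 2 v)) {0..2 * pi}" for v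
    using has_integral_bessel[of v \<alpha> 2] by (simp add: mult_ac)
  \<comment> \<open>Bessel's integral supplies the factor with frequency \<open>- 2\<close>;
    conjugating it at \<open>- w\<close> supplies frequency \<open>2\<close> with the same kernel,
    and \<open>bessel_J 2\<close> is real and even.\<close>
  have "((cnj \<circ> (\<lambda>t. exp (\<i> * of_real (- w * sin (t - \<alpha>))) * exp (- (2 * \<i> * of_real (t - \<alpha>))))) has_integral
      cnj (2 * of_real pi * of_real (bessel_J 2 (- w)))) {0..2 * pi}"
    using J2[of "- w"] by (simp only: has_integral_cnj)
  then have J2': "((\<lambda>t. exp (\<i> * of_real (w * sin (t - \<alpha>))) * exp (2 * \<i> * of_real (t - \<alpha>))) has_integral
      2 * of_real pi * of_real (bessel_J 2 w)) {0..2 * pi}"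
    using bessel_J_even[of 2 w] by (simp add: o_def exp_cnj)
  have eq: "of_real (cos x + cos (2 * s)) * exp (\<i> * of_real (w * sin s)) =
     of_real (cos x) * exp (\<i> * of_real (w * sin s)) +
     (exp (\<i> * of_real (w * sin s)) * exp (- (2 * \<i> * of_real s)) +
      exp (\<i> * of_real (w * sin s)) * exp (2 * \<i> * of_real s)) / 2" for s
  proof -
    have cos: "complex_of_real (cos (2 * s)) = (exp (2 * \<i> * of_real s) + exp (- (2 * \<i> * of_real s))) / 2"
      unfolding cos_of_real[symmetric] cos_exp_eq by (simp add: mult_ac)
    show ?thesis unfolding of_real_add cos by (simp add: algebra_simps add_divide_distrib)
  qed
  have "((\<lambda>t. of_real (cos x + cos (2 * (t - \<alpha>))) * exp (\<i> * of_real (w * sin (t - \<alpha>)))) has_integral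
     of_real (cos x) * (2 * of_real pi * of_real (bessel_J 0 w)) +
     (2 * of_real pi * of_real (bessel_J 2 w) + 2 * of_real pi * of_real (bessel_J 2 w)) / 2) {0..2 * pi}"
    unfolding eq by (intro has_integral_add has_integral_divide has_integral_mult_right J0 J2 J2')
  then show ?thesis by (simp add: algebra_simps)
qed

text \<open>Chain rule; by linearity of the derivative, pairing the two partial derivatives with
  \<open>v\<close> gives the derivative in direction \<open>v\<close>.\<close>

lemma normal_derivative_plane_wave:
  "dot (gradient (plane_wave \<kappa> p m) x) v =
     \<i> * of_real (\<kappa> * inner (direction p m) v) * plane_wave \<kappa> p m x"
proof -
  have "((\<lambda>x. \<i> * complex_of_real (\<kappa> * inner (direction p m) x)) has_derivative
         (\<lambda>v. \<i> * of_real (\<kappa> * inner (direction p m) v))) (at x)"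
    by (auto intro!: derivative_eq_intros)
  from has_derivative_compose[OF this DERIV_exp[unfolded has_field_derivative_def]]
  have "(plane_wave \<kappa> p m has_derivative
         (\<lambda>v. plane_wave \<kappa> p m x * (\<i> * of_real (\<kappa> * inner (direction p m) v)))) (at x)"
    by (simp add: plane_wave_def[abs_def])
  from frechet_derivative_at[OF this, symmetric] show ?thesis
    by (cases v) (simp add: gradient_def dot_def direction_def algebra_simps)
qed

lemma inner_direction_circle:
  "inner (direction p m) (cos t, sin t) = cos (t - 2 * pi * real m / real p)"
  by (simp add: direction_def cos_diff mult.commute)

text \<open>With the angle measured from the mean \<open>\<alpha>\<close> of the two wave
  directions, the phases combine into a multiple of \<open>sin (t - \<alpha>)\<close> and the
  cosines into \<open>cos x + cos (2 * (t - \<alpha>))\<close>. The prefactor collects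
  \<open>h\<close> from arclength, \<open>\<kappa>\<^sup>2\<close> from the two normal derivatives,
  and \<open>pi\<close> from \<open>2 * pi\<close> halved.\<close>

lemma stiffness_matrix_entry:
  assumes h: "h > 0" and "m < p" "l < p"
  shows "stiffness_matrix \<kappa> h p $$ (m, l) =
         of_real (F_D \<kappa> h (2 * pi * real l / real p - 2 * pi * real m / real p))"
proof -
  define a where "a = 2 * pi * real m / real p"
  define b where "b = 2 * pi * real l / real p"
  define \<alpha> where "\<alpha> = (a + b) / 2"
  define x where "x = b - a"
  \<comment> \<open>The minus sign comes from \<open>cos (s + x / 2) - cos (s - x / 2) = - 2 * sin s
    * sin (x / 2)\<close>; evenness of the Bessel functions removes it at the end.\<close>
  define w where "w = - (2 * \<kappa> * h * sin (x / 2))"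
  have circle: "circle h t = h *\<^sub>R (cos t, sin t)" for t by (simp add: circle_def)
  have norm: "norm (cos t, sin t) = 1" for t :: real by (simp add: norm_prod_def)
  have normal: "outward_normal (circle h t) = (cos t, sin t)" for t
    unfolding outward_normal_def circle norm_scaleR norm using h by simp
  have "(circle h has_vector_derivative (- h * sin t, h * cos t)) (at t)" for t
    unfolding circle_def[abs_def] by (intro has_vector_derivative_Pair)
      (auto simp flip: has_real_derivative_iff_has_vector_derivative intro!: derivative_eq_intros)
  then have "vector_derivative (circle h) (at t) = (- h * sin t, h * cos t)" for t
    by (rule vector_derivative_at)
  \<comment> \<open>The tangent is \<open>h\<close> times the unit vector at angle
    \<open>t + pi / 2\<close>.\<close>
  moreover have "norm (- h * sin t, h * cos t) = h" for t
    using norm[of "t + pi / 2"] h by (simp add: norm_prod_def power_mult_distrib flip: distrib_left)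
  ultimately have speed: "norm (vector_derivative (circle h) (at t)) = h" for t by simp
  have integrand: "h *\<^sub>R (dot (gradient (plane_wave \<kappa> p m) (circle h t)) (outward_normal (circle h t)) *
      cnj (dot (gradient (plane_wave \<kappa> p l) (circle h t)) (outward_normal (circle h t)))) =
    of_real (h * \<kappa>\<^sup>2 / 2) * (of_real (cos x + cos (2 * (t - \<alpha>))) * exp (\<i> * of_real (w * sin (t - \<alpha>))))" for t
  proof -
    have ta: "t - a = (t - \<alpha>) + x / 2" and tb: "t - b = (t - \<alpha>) - x / 2"
      by (simp_all add: \<alpha>_def x_def field_simps)
    have prod: "cos (t - a) * cos (t - b) = (cos x + cos (2 * (t - \<alpha>))) / 2"
      unfolding cos_times_cos by (simp add: ta tb algebra_simps)
    have diff: "\<kappa> * (h * cos (t - a)) - \<kappa> * (h * cos (t - b)) = w * sin (t - \<alpha>)"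
      unfolding ta tb cos_add cos_diff w_def by (simp add: algebra_simps)
    have "exp (\<i> * of_real (\<kappa> * (h * cos (t - a)))) * exp (- (\<i> * of_real (\<kappa> * (h * cos (t - b))))) =
          exp (\<i> * of_real (w * sin (t - \<alpha>)))"
      unfolding exp_add[symmetric] diff[symmetric] by (simp add: algebra_simps)
    moreover have "dot (gradient (plane_wave \<kappa> p m) (circle h t)) (outward_normal (circle h t)) =
      \<i> * of_real (\<kappa> * cos (t - a)) * exp (\<i> * of_real (\<kappa> * (h * cos (t - a))))"
      unfolding normal_derivative_plane_wave normal
      unfolding plane_wave_def circle inner_scaleR_right
        inner_direction_circle a_def ..
    moreover have "dot (gradient (plane_wave \<kappa> p l) (circle h t)) (outward_normal (circle h t)) =
      \<i> * of_real (\<kappa> * cos (t - b)) * exp (\<i> * of_real (\<kappa> * (h * cos (t - b))))"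
      unfolding normal_derivative_plane_wave normal
      unfolding plane_wave_def circle inner_scaleR_right
        inner_direction_circle b_def ..
    ultimately have "h *\<^sub>R (dot (gradient (plane_wave \<kappa> p m) (circle h t)) (outward_normal (circle h t)) *
      cnj (dot (gradient (plane_wave \<kappa> p l) (circle h t)) (outward_normal (circle h t)))) =
      of_real (h * \<kappa>\<^sup>2 * (cos (t - a) * cos (t - b))) * exp (\<i> * of_real (w * sin (t - \<alpha>)))"
      by (simp add: scaleR_conv_of_real exp_cnj power2_eq_square mult_ac)
    then show ?thesis unfolding prod by simp
  qed
  have "stiffness_matrix \<kappa> h p $$ (m, l) =
    integral {0..2 * pi} (\<lambda>t. of_real (h * \<kappa>\<^sup>2 / 2) *
      (of_real (cos x + cos (2 * (t - \<alpha>))) * exp (\<i> * of_real (w * sin (t - \<alpha>)))))"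
    using assms by (simp only: stiffness_matrix_def curve_integral_def index_mat split speed integrand)
  also have "\<dots> = of_real (h * \<kappa>\<^sup>2 / 2) * of_real (2 * pi * (cos x * bessel_J 0 w + bessel_J 2 w))"
    by (intro integral_unique has_integral_mult_right has_integral_bessel_cos)
  also have "\<dots> = of_real (F_D \<kappa> h x)"
    using bessel_J_even[of 0 w] bessel_J_even[of 2 w] by (simp add: F_D_def w_def)
  finally show ?thesis by (simp add: x_def a_def b_def)
qed

text \<open>Entries depend only on the difference of the two angles; for \<open>m > l\<close> the
  cyclic index adds \<open>p\<close>, that is, one full period of \<open>F_D\<close>.\<close>

lemma stiffness_matrix_eq_circ:
  assumes "h > 0"
  shows "stiffness_matrix \<kappa> h p = circ p (\<lambda>j. of_real (F_D \<kappa> h (2 * pi * real j / real p)))"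
proof (rule eq_matI)
  fix m l assume "m < dim_row (circ p (\<lambda>j. complex_of_real (F_D \<kappa> h (2 * pi * real j / real p))))"
    "l < dim_col (circ p (\<lambda>j. complex_of_real (F_D \<kappa> h (2 * pi * real j / real p))))"
  then have ml: "m < p" "l < p" by (auto simp: circ_def)
  let ?x = "2 * pi * real l / real p - 2 * pi * real m / real p"
  have "F_D \<kappa> h (2 * pi * real ((l + p - m) mod p) / real p) = F_D \<kappa> h ?x"
  proof (cases "m \<le> l")
    case True
    then have "(l + p - m) mod p = l - m" using ml by (simp add: mod_if)
    then show ?thesis using True by (simp add: of_nat_diff algebra_simps diff_divide_distrib)
  next
    case False
    then have "(l + p - m) mod p = l + p - m" using ml by simp
    moreover have "2 * pi * real (l + p - m) / real p = ?x + 2 * pi"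
      using ml by (simp add: of_nat_diff field_simps)
    ultimately show ?thesis using F_D_periodic by metis
  qed
  then show "stiffness_matrix \<kappa> h p $$ (m, l) =
      circ p (\<lambda>j. of_real (F_D \<kappa> h (2 * pi * real j / real p))) $$ (m, l)"
    using ml by (simp add: stiffness_matrix_entry[OF assms] circ_def)
qed (auto simp: stiffness_matrix_def circ_def)

text \<open>The factorization of the characteristic polynomial holds unconditionally. The exact
  orders 1 and 2 assume \<open>ev\<close> injective on \<open>{0..p div 2}\<close>, because values
  from different factors can coincide: at \<open>\<kappa> = 0\<close> all eigenvalues
  vanish.\<close>

theorem theorem3p5:
  fixes \<kappa> h :: real and p :: nat and D :: "complex mat" and ev :: "nat \<Rightarrow> complex"
  assumes "h > 0" and "p \<ge> 1"
    and D: "D = stiffness_matrix \<kappa> h p"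
    and ev: "ev = circ_eigenvalue D"
  shows
    "generating_function p (F_D \<kappa> h) D \<and>

     char_poly D =
       [:- ev 0, 1:] * (\<Prod>L = 1..(p - 1) div 2. [:- ev L, 1:] ^ 2) *
       (if even p then [:- ev (p div 2), 1:] else 1) \<and>

     (eigenvalue D (ev 0) \<and>
      (inj_on ev {0..p div 2} \<longrightarrow> Polynomial.order (ev 0) (char_poly D) = 1) \<and>
      trapezoidal_approx p (F_D \<kappa> h) 0 (ev 0)
        (of_real (1 / 2 * real p * \<kappa>\<^sup>2 * h *
           integral {0..2 * pi} (\<lambda>x.
             bessel_J 0 (2 * \<kappa> * h * sin (x / 2)) * cos x +
             bessel_J 2 (2 * \<kappa> * h * sin (x / 2)))))) \<and>

     (\<forall>L\<in>{1..(p - 1) div 2}.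
        eigenvalue D (ev L) \<and> ev (p - L) = ev L \<and>
        (inj_on ev {0..p div 2} \<longrightarrow> Polynomial.order (ev L) (char_poly D) = 2) \<and>
        ev L = (\<Sum>j<p. of_real (F_D \<kappa> h (2 * real j / real p * pi)) *
                  exp (- (\<i> * of_real (2 * real j / real p * real L * pi)))) \<and>
        trapezoidal_approx p (F_D \<kappa> h) L (ev L)
          (of_real (1 / 4 * real p * \<kappa>\<^sup>2 * h *
             integral {0..2 * pi} (\<lambda>t.
               (bessel_J (2 * int L + 2) (2 * \<kappa> * h * sin t) +
                bessel_J (2 * int L - 2) (2 * \<kappa> * h * sin t)) +
               2 * bessel_J (2 * int L) (2 * \<kappa> * h * sin t) * cos (2 * t))))) \<and>

     (even p \<longrightarrow>
        eigenvalue D (ev (p div 2)) \<and>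
        (inj_on ev {0..p div 2} \<longrightarrow> Polynomial.order (ev (p div 2)) (char_poly D) = 1) \<and>
        ev (p div 2) = (\<Sum>j<p. (-1) ^ j * of_real (F_D \<kappa> h (2 * real j / real p * pi))))"
proof -
  define c where "c j = complex_of_real (F_D \<kappa> h (2 * pi * real j / real p))" for j :: nat
  have Dc: "D = circ p c"
    unfolding D c_def[abs_def] by (rule stiffness_matrix_eq_circ[OF \<open>h > 0\<close>])
  have carrier: "D \<in> carrier_mat p p" by (simp add: Dc circ_def)
  \<comment> \<open>Node \<open>p - j\<close> is the reflection of node \<open>j\<close>, up to a
    period.\<close>
  have sym_c: "c (p - j) = c j" if "1 \<le> j" "j < p" for j
  proof -
    have "2 * pi * real (p - j) / real p = - (2 * pi * real j / real p) + 2 * pi"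
      using that by (simp add: of_nat_diff field_simps)
    then show ?thesis unfolding c_def by (simp only: F_D_periodic F_D_even)
  qed
  have reflect: "ev (p - L) = ev L" if "L \<le> p" for L
    unfolding ev Dc using that sym_c by (rule circ_eigenvalue_reflect)
  have char_poly: "char_poly D = (\<Prod>L<p. [:- ev L, 1:])"
    unfolding ev Dc by (rule char_poly_circ)
  have eigenvalue: "eigenvalue D (ev L)" if "L < p" for L
    unfolding eigenvalue_root_char_poly[OF carrier] char_poly poly_prod
    using that by (auto simp: prod_zero_iff)
  have order: "Polynomial.order (ev M) (char_poly D) = card ({M, p - M} \<inter> {..<p})"
    if "inj_on ev {0..p div 2}" "M \<le> p div 2" for M
    unfolding char_poly using reflect that by (rule order_prod_reflect)
  have ev_sum: "ev L = (\<Sum>j<p. c j * exp (- (2 * of_real pi * \<i> * of_nat j * of_nat L / of_nat p)))" for L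
    unfolding ev Dc circ_eigenvalue_circ unity_root_power by (simp add: mult.assoc)

  have "generating_function p (F_D \<kappa> h) D"
    unfolding generating_function_def Dc c_def by blast
  moreover have "char_poly D =
       [:- ev 0, 1:] * (\<Prod>L = 1..(p - 1) div 2. [:- ev L, 1:] ^ 2) *
       (if even p then [:- ev (p div 2), 1:] else 1)"
    unfolding char_poly using \<open>p \<ge> 1\<close> by (rule prod_lessThan_symmetric) (simp add: reflect)
  moreover have "eigenvalue D (ev 0)" using eigenvalue \<open>p \<ge> 1\<close> by simp
  moreover have "Polynomial.order (ev 0) (char_poly D) = 1" if "inj_on ev {0..p div 2}"
  proof -
    have "{0, p - 0} \<inter> {..<p} = {0}" using \<open>p \<ge> 1\<close> by auto
    then show ?thesis using order[OF that, of 0] by simp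
  qed
  moreover have "trapezoidal_approx p (F_D \<kappa> h) 0 (ev 0)
        (of_real (1 / 2 * real p * \<kappa>\<^sup>2 * h *
           integral {0..2 * pi} (\<lambda>x.
             bessel_J 0 (2 * \<kappa> * h * sin (x / 2)) * cos x +
             bessel_J 2 (2 * \<kappa> * h * sin (x / 2)))))"
    \<comment> \<open>At frequency 0 the exponential is 1, and \<open>p / (2 * pi)\<close> times
      \<open>pi * h * \<kappa>\<^sup>2\<close> gives the constant
      \<open>1 / 2 * p * \<kappa>\<^sup>2 * h\<close>.\<close>
    unfolding trapezoidal_approx_def ev_sum c_def
    using has_integral_of_real[OF has_integral_F_D[of \<kappa> h], where 'b = complex]
    by (intro conjI refl exI) (auto simp: field_simps)
  moreover have "eigenvalue D (ev L) \<and> ev (p - L) = ev L \<and>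
        (inj_on ev {0..p div 2} \<longrightarrow> Polynomial.order (ev L) (char_poly D) = 2) \<and>
        ev L = (\<Sum>j<p. of_real (F_D \<kappa> h (2 * real j / real p * pi)) *
                  exp (- (\<i> * of_real (2 * real j / real p * real L * pi)))) \<and>
        trapezoidal_approx p (F_D \<kappa> h) L (ev L)
          (of_real (1 / 4 * real p * \<kappa>\<^sup>2 * h *
             integral {0..2 * pi} (\<lambda>t.
               (bessel_J (2 * int L + 2) (2 * \<kappa> * h * sin t) +
                bessel_J (2 * int L - 2) (2 * \<kappa> * h * sin t)) +
               2 * bessel_J (2 * int L) (2 * \<kappa> * h * sin t) * cos (2 * t))))"
    if "L \<in> {1..(p - 1) div 2}" for L
  proof (intro conjI impI)
    \<comment> \<open>The bound \<open>(p - 1) div 2\<close> makes \<open>L < p - L\<close> strict,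
      so the two reflected indices are distinct and the order is 2.\<close>
    have L: "1 \<le> L" "L < p" "L \<le> p div 2" "L < p - L" using that by auto
    show "eigenvalue D (ev L)" "ev (p - L) = ev L" using L eigenvalue reflect by auto
    have "{L, p - L} \<inter> {..<p} = {L, p - L}" using L by auto
    then show "Polynomial.order (ev L) (char_poly D) = 2" if "inj_on ev {0..p div 2}"
      using order[OF that L(3)] L by simp
    show "ev L = (\<Sum>j<p. of_real (F_D \<kappa> h (2 * real j / real p * pi)) *
                  exp (- (\<i> * of_real (2 * real j / real p * real L * pi))))"
      unfolding ev_sum c_def by (intro sum.cong refl) (simp add: mult_ac)
    show "trapezoidal_approx p (F_D \<kappa> h) L (ev L)
          (of_real (1 / 4 * real p * \<kappa>\<^sup>2 * h *
             integral {0..2 * pi} (\<lambda>t.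
               (bessel_J (2 * int L + 2) (2 * \<kappa> * h * sin t) +
                bessel_J (2 * int L - 2) (2 * \<kappa> * h * sin t)) +
               2 * bessel_J (2 * int L) (2 * \<kappa> * h * sin t) * cos (2 * t))))"
      \<comment> \<open>The factor \<open>1 / 4\<close> is \<open>p / (2 * pi)\<close> times
        \<open>pi / 2\<close>, with \<open>p\<close> split off.\<close>
      unfolding trapezoidal_approx_def ev_sum c_def
      by (intro conjI refl exI, rule has_integral_F_D_fourier[OF L(1)]) (simp add: field_simps)
  qed
  moreover have "eigenvalue D (ev (p div 2)) \<and>
        (inj_on ev {0..p div 2} \<longrightarrow> Polynomial.order (ev (p div 2)) (char_poly D) = 1) \<and>
        ev (p div 2) = (\<Sum>j<p. (-1) ^ j * of_real (F_D \<kappa> h (2 * real j / real p * pi)))"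
    if "even p"
  proof (intro conjI impI)
    from that obtain q where q: "p = 2 * q" by blast
    with \<open>p \<ge> 1\<close> have q0: "q \<ge> 1" by simp
    show "eigenvalue D (ev (p div 2))" using q q0 by (intro eigenvalue) simp
    have "{p div 2, p - p div 2} \<inter> {..<p} = {p div 2}" using q q0 by auto
    then show "Polynomial.order (ev (p div 2)) (char_poly D) = 1" if "inj_on ev {0..p div 2}"
      using order[OF that, of "p div 2"] by simp
    \<comment> \<open>At \<open>L = p div 2\<close> the nodes' exponentials are powers of
      \<open>exp (- (of_real pi * \<i>)) = - 1\<close>.\<close>
    have "exp (- (2 * of_real pi * \<i> * of_nat j * of_nat (p div 2) / of_nat p)) = (- 1 :: complex) ^ j" for j
    proof -
      have "- (2 * of_real pi * \<i> * of_nat j * of_nat (p div 2) / of_nat p) = of_nat j * (- (of_real pi * \<i>))"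
        using q0 by (simp add: q)
      then have "exp (- (2 * of_real pi * \<i> * of_nat j * of_nat (p div 2) / of_nat p)) = exp (- (of_real pi * \<i>)) ^ j"
        by (simp only: exp_of_nat_mult)
      then show ?thesis by (simp add: exp_minus)
    qed
    then show "ev (p div 2) = (\<Sum>j<p. (-1) ^ j * of_real (F_D \<kappa> h (2 * real j / real p * pi)))"
      unfolding ev_sum c_def by (simp add: mult_ac)
  qed
  ultimately show ?thesis by blast
qed

end
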